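(* Let $\mathrm{Re}(s)>0$, $\mathrm{Re}(p)>0$, $\mathrm{Re}(x+s)>0$, $\mathrm{Re}(y+s)>0$, $\mathrm{Re}(\alpha)>0$, with $\beta,\gamma\in\mathbb{C}$. Then the Mellin transform (in the variable $p$) of the ML-generalized beta function is $$\mathfrak{M}\left[{}^{ML}B_{p}(x,y):s\right]=\int_0^\infty p^{s-1}\;{}^{ML}B_{p}(x,y)\,dp={}^{ML}\Gamma(s)\,B(x+s,y+s).$$
   Context: The three-parameter Mittag-Leffler function is $E_{\alpha,\beta}^{\gamma}(z)=\sum_{n=0}^{\infty}\frac{(\gamma)_n}{\Gamma(\alpha n+\beta)}\frac{z^n}{n!}$ for $\alpha,\beta,\gamma\in\mathbb{C}$, $\mathrm{Re}(\alpha)>0$, where $(\gamma)_n=\gamma(\gamma+1)\cdots(\gamma+n-1)$, $(\gamma)_0=1$. The ML-generalized beta function is ${}^{ML}B_{p}(x,y)=\int_{0}^{1}t^{x-1}(1-t)^{y-1}E_{\alpha,\beta}^{\gamma}\left(-\frac{p}{t(1-t)}\right)dt$ (the parameters $\alpha,\beta,\gamma$ are suppressed in the notation). Moreover ${}^{ML}\Gamma(s)=\int_0^\infty u^{s-1}E_{\alpha,\beta}^{\gamma}(-u)\,du$, and $B(x,y)=\int_0^1 t^{x-1}(1-t)^{y-1}dt$ is the classical beta function.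
   Formalization: The formal theorem additionally assumes that the integral defining ^{ML}Γ(s) converges (possibly conditionally); it can diverge under the stated conditions, e.g. for α=2, β=γ=1, Re(s)≥1/2, where the right-hand side is undefined. *)

theory Defs
  imports "HOL-Analysis.Analysis"
begin

(* Improper integrals are Henstock-Kurzweil integrals ("integral", "integrable_on"), which include
   conditionally convergent ones. "integral S f" is 0 if f is not integrable on S, so equations
   between integrals are meaningful only together with integrability. *)

(* The library has Gamma z = 0 at the poles z = 0, -1, -2, ... and w / 0 = 0, so the terms of the
   series with \<alpha> n + \<beta> a pole of Gamma vanish, as they should: 1 / Gamma is 0 there. *)
definition mittag_leffler3 :: "complex \<Rightarrow> complex \<Rightarrow> complex \<Rightarrow> complex \<Rightarrow> complex" where
  "mittag_leffler3 \<alpha> \<beta> \<gamma> z =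
     (\<Sum>n. pochhammer \<gamma> n / Gamma (\<alpha> * of_nat n + \<beta>) * (z ^ n / fact n))"

definition ml_gamma_integrand ::
    "complex \<Rightarrow> complex \<Rightarrow> complex \<Rightarrow> complex \<Rightarrow> real \<Rightarrow> complex" where
  "ml_gamma_integrand \<alpha> \<beta> \<gamma> s u =
     of_real u powr (s - 1) * mittag_leffler3 \<alpha> \<beta> \<gamma> (- of_real u)"

definition ml_gamma :: "complex \<Rightarrow> complex \<Rightarrow> complex \<Rightarrow> complex \<Rightarrow> complex" where
  "ml_gamma \<alpha> \<beta> \<gamma> s = integral {0<..} (ml_gamma_integrand \<alpha> \<beta> \<gamma> s)"

definition ml_beta_integrand ::
    "complex \<Rightarrow> complex \<Rightarrow> complex \<Rightarrow> complex \<Rightarrow> complex \<Rightarrow> complex \<Rightarrow> real \<Rightarrow> complex" where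
  "ml_beta_integrand \<alpha> \<beta> \<gamma> p x y t =
     of_real t powr (x - 1) * of_real (1 - t) powr (y - 1) *
     mittag_leffler3 \<alpha> \<beta> \<gamma> (- (p / of_real (t * (1 - t))))"

definition ml_beta ::
    "complex \<Rightarrow> complex \<Rightarrow> complex \<Rightarrow> complex \<Rightarrow> complex \<Rightarrow> complex \<Rightarrow> complex" where
  "ml_beta \<alpha> \<beta> \<gamma> p x y = integral {0<..<1} (ml_beta_integrand \<alpha> \<beta> \<gamma> p x y)"

definition mellin_integrand :: "(real \<Rightarrow> complex) \<Rightarrow> complex \<Rightarrow> real \<Rightarrow> complex" where
  "mellin_integrand f s p = of_real p powr (s - 1) * f p"

definition mellin_transform :: "(real \<Rightarrow> complex) \<Rightarrow> complex \<Rightarrow> complex" where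
  "mellin_transform f s = integral {0<..} (mellin_integrand f s)"

end

theory Submission
  imports Defs
begin

text \<open>
  Write \<open>E u\<close> for the Mittag-Leffler function at \<open>-u\<close>, \<open>\<tau> = t (1 - t)\<close>, and \<open>F u\<close> for the integral of
  \<open>v powr (s - 1) * E v\<close> over \<open>0 \<le> v \<le> u\<close>. Only conditional convergence of \<open>F\<close> at infinity is available, so
  Fubini's theorem does not apply to the double integral. Instead the \<open>p\<close>-integral is done first: the integral
  \<open>K p\<close> of \<open>t powr (x + s - 1) * (1 - t) powr (y + s - 1) * F (p / \<tau>)\<close> over \<open>t\<close> converges absolutely because \<open>F\<close> is
  bounded, and by dominated convergence \<open>K p\<close> is continuous, vanishes at 0 and tends to \<open>F \<infinity> * B(x + s, y + s)\<close>.
  Differentiation under the integral sign gives \<open>p powr (s - 1)\<close> times the generalized beta function as the derivative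
  of \<open>K\<close>; it is justified on \<open>t \<ge> \<delta>\<close>, and an integration by parts in \<open>t\<close> shows that the part \<open>t < \<delta>\<close>
  is small locally uniformly in \<open>p\<close>. Near \<open>t = 1\<close> one uses the symmetry \<open>t \<mapsto> 1 - t\<close>, so all this is done on
  \<open>t \<le> 1/2\<close>.
\<close>

subsection \<open>The complex Beta integral\<close>

lemma continuous_dominated_absolutely_integrable:
  fixes f :: "real \<Rightarrow> complex"
  assumes "open S" "continuous_on S f" "g integrable_on S" "\<And>t. t \<in> S \<Longrightarrow> norm (f t) \<le> g t"
  shows "f absolutely_integrable_on S"
  using assms
  by (intro measurable_bounded_by_integrable_imp_absolutely_integrable[where g = g]
        continuous_imp_measurable_on_sets_lebesgue) auto

lemma norm_of_real_powr: "t > 0 \<Longrightarrow> norm (complex_of_real t powr z) = t powr Re z"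
  by (simp add: norm_powr_real_powr)

lemma of_real_powr_minus_1: "t > 0 \<Longrightarrow> complex_of_real t powr (z - 1) = of_real t powr z / of_real t"
  by (simp add: powr_diff)

lemma continuous_on_of_real_powr_complex:
  assumes "continuous_on S f" "\<And>t. t \<in> S \<Longrightarrow> f t > 0"
  shows "continuous_on S (\<lambda>t. complex_of_real (f t) powr z)"
  using assms by (intro continuous_intros) (force simp: complex_nonpos_Reals_iff)+

definition beta_integrand :: "complex \<Rightarrow> complex \<Rightarrow> real \<Rightarrow> complex" where
  "beta_integrand a b t = of_real t powr (a - 1) * of_real (1 - t) powr (b - 1)"

lemma continuous_on_beta_integrand: "continuous_on {0<..<1} (beta_integrand a b)"
  unfolding beta_integrand_def
  by (intro continuous_on_mult continuous_on_of_real_powr_complex continuous_intros) auto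

lemma norm_beta_integrand:
  "t \<in> {0<..<1} \<Longrightarrow> norm (beta_integrand a b t) = t powr (Re a - 1) * (1 - t) powr (Re b - 1)"
  unfolding beta_integrand_def by (simp only: norm_mult) (simp add: norm_of_real_powr del: of_real_diff)

lemma absolutely_integrable_beta_integrand:
  assumes "Re a > 0" "Re b > 0"
  shows "beta_integrand a b absolutely_integrable_on {0<..<1}"
proof (rule continuous_dominated_absolutely_integrable)
  show "(\<lambda>t. t powr (Re a - 1) * (1 - t) powr (Re b - 1)) integrable_on {0<..<1}"
    using has_integral_Beta_real[OF assms] by (auto simp: has_integral_Icc_iff_Ioo)
qed (auto simp: continuous_on_beta_integrand norm_beta_integrand)

lemma integrable_beta_integrand:
  "\<lbrakk>Re a > 0; Re b > 0\<rbrakk> \<Longrightarrow> beta_integrand a b integrable_on {0<..<1}"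
  using absolutely_integrable_beta_integrand set_lebesgue_integral_eq_integral(1) by blast

text \<open>The derivative of \<open>t powr a * (1 - t) powr b\<close> integrates to 0, which
  relates the integrals at (a, b + 1) and (a + 1, b). Splitting 1 = t + (1 - t) gives a second
  relation, and eliminating the integral at (a + 1, b) leaves this one.\<close>

lemma integral_beta_integrand_plus1:
  assumes a: "Re a > 0" and b: "Re b > 0"
  shows "(a + b) * integral {0<..<1} (beta_integrand a (b + 1)) =
         b * integral {0<..<1} (beta_integrand a b)"
proof -
  let ?I = "\<lambda>a b. integral {0<..<1} (beta_integrand a b)"
  note int = integrable_beta_integrand
  have "((\<lambda>t. a * beta_integrand a (b + 1) t - b * beta_integrand (a + 1) b t) has_integral
         (of_real 1 powr a * of_real (1 - 1) powr b - of_real 0 powr a * of_real (1 - 0) powr b)) {0..1}"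
  proof (rule fundamental_theorem_of_calculus_interior)
    show "continuous_on {0..1} (\<lambda>t. complex_of_real t powr a * of_real (1 - t) powr b)"
      using a b by (auto intro!: continuous_intros)
    show "((\<lambda>t. complex_of_real t powr a * of_real (1 - t) powr b) has_vector_derivative
        a * beta_integrand a (b + 1) t - b * beta_integrand (a + 1) b t) (at t)" if "t \<in> {0<..<1}" for t
    proof -
      have "((\<lambda>z. z powr a * (1 - z) powr b) has_field_derivative
         a * beta_integrand a (b + 1) t - b * beta_integrand (a + 1) b t) (at (complex_of_real t))"
        using that unfolding beta_integrand_def
        by (auto intro!: derivative_eq_intros simp: complex_nonpos_Reals_iff)
      from has_vector_derivative_real_field[OF this] show ?thesis by simp
    qed
  qed auto
  \<comment> \<open>Both boundary terms vanish because \<open>0 powr z = 0\<close>.\<close>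
  then have "((\<lambda>t. a * beta_integrand a (b + 1) t - b * beta_integrand (a + 1) b t) has_integral 0) {0<..<1}"
    by (simp add: has_integral_Icc_iff_Ioo)
  moreover have "((\<lambda>t. a * beta_integrand a (b + 1) t - b * beta_integrand (a + 1) b t) has_integral
        (a * ?I a (b + 1) - b * ?I (a + 1) b)) {0<..<1}"
    using a b by (intro has_integral_diff has_integral_mult_right integrable_integral int) auto
  ultimately have "0 = a * ?I a (b + 1) - b * ?I (a + 1) b"
    by (rule has_integral_unique)
  then have 1: "a * ?I a (b + 1) = b * ?I (a + 1) b"
    by simp
  have "((\<lambda>t. beta_integrand a (b + 1) t + beta_integrand (a + 1) b t) has_integral
        (?I a (b + 1) + ?I (a + 1) b)) {0<..<1}"
    using a b by (intro has_integral_add integrable_integral int) auto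
  moreover have "beta_integrand a (b + 1) t + beta_integrand (a + 1) b t = beta_integrand a b t"
    if "t \<in> {0<..<1}" for t
    using that by (simp add: beta_integrand_def powr_diff field_simps del: of_real_diff)
       (simp add: field_simps)
  ultimately have "(beta_integrand a b has_integral (?I a (b + 1) + ?I (a + 1) b)) {0<..<1}"
    by (rule has_integral_eq[rotated]) auto
  then have 2: "?I a b = ?I a (b + 1) + ?I (a + 1) b" by (rule integral_unique)
  show ?thesis unfolding 2 using 1 by (simp add: algebra_simps)
qed

text \<open>Substituting t = u / n turns the left side into the integral of
  \<open>u powr (a - 1) * (1 - u / n) powr (b + n - 1)\<close> over 0 < u < n. The second factor
  tends to exp (-u), so dominated convergence yields the Gamma integral.\<close>

lemma integral_beta_integrand_asymp:
  assumes a: "Re a > 0" and b: "Re b > 0"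
  shows "(\<lambda>n. of_nat n powr a * integral {0<..<1} (beta_integrand a (b + of_nat n))) \<longlonglongrightarrow> Gamma a"
proof -
  \<comment> \<open>Extension by 0 beyond n puts all the substituted integrands on the same
    half-line.\<close>
  define f where "f = (\<lambda>n u. if u \<in> {0<..<real n} then
      of_real u powr (a - 1) * of_real (1 - u / n) powr (b + of_nat n - 1) else 0)"
  have f: "(f n has_integral of_nat n powr a * integral {0<..<1} (beta_integrand a (b + of_nat n))) {0<..}"
    if n: "n > 0" for n
  proof -
    have "(beta_integrand a (b + of_nat n) has_integral integral {0<..<1} (beta_integrand a (b + of_nat n))) {0..1}"
      unfolding has_integral_Icc_iff_Ioo using a b by (intro integrable_integral integrable_beta_integrand) auto
    from has_integral_affinity01[OF this, of "inverse n" 0]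
    have "((\<lambda>u. beta_integrand a (b + of_nat n) (u / n)) has_integral
            of_nat n * integral {0<..<1} (beta_integrand a (b + of_nat n))) ((\<lambda>u. real n * u) ` {0..1})"
      using n by (simp add: field_simps scaleR_conv_of_real)
    also have "((\<lambda>u. real n * u) ` {0..1}) = {0..real n}"
      using n by (subst image_mult_atLeastAtMost) simp_all
    finally have "((\<lambda>u. of_nat n powr (a - 1) * beta_integrand a (b + of_nat n) (u / n)) has_integral
            of_nat n powr (a - 1) * (of_nat n * integral {0<..<1} (beta_integrand a (b + of_nat n)))) {0<..<real n}"
      unfolding has_integral_Icc_iff_Ioo by (rule has_integral_mult_right)
    also have "of_nat n powr (a - 1) * (of_nat n * integral {0<..<1} (beta_integrand a (b + of_nat n)))
       = of_nat n powr a * integral {0<..<1} (beta_integrand a (b + of_nat n))"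
      using n by (simp add: powr_diff)
    finally have "((\<lambda>u. of_real u powr (a - 1) * of_real (1 - u / n) powr (b + of_nat n - 1)) has_integral
            of_nat n powr a * integral {0<..<1} (beta_integrand a (b + of_nat n))) {0<..<real n}"
    proof (rule has_integral_eq[rotated])
      fix u assume u: "u \<in> {0<..<real n}"
      have "complex_of_real u powr (a - 1) = (of_real (real n) * of_real (u / n)) powr (a - 1)"
        using u n by simp
      also have "\<dots> = of_nat n powr (a - 1) * of_real (u / n) powr (a - 1)"
        using u by (subst powr_times_real) auto
      finally show "of_nat n powr (a - 1) * beta_integrand a (b + of_nat n) (u / n) =
          of_real u powr (a - 1) * of_real (1 - u / n) powr (b + of_nat n - 1)"
        by (simp add: beta_integrand_def)
    qed
    then show ?thesis unfolding f_def by (subst has_integral_restrict) auto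
  qed
  have lim: "(\<lambda>n. f n u) \<longlonglongrightarrow> of_real u powr (a - 1) / of_real (exp u)" if u: "u \<in> {0<..}" for u
  proof -
    have "(\<lambda>n. (1 - u / real n) ^ n) \<longlonglongrightarrow> exp (-u)"
      using tendsto_exp_limit_sequentially[of "-u"] by simp
    moreover have "(\<lambda>n. 1 - u / real n) \<longlonglongrightarrow> 1 - 0"
      by (intro tendsto_intros tendsto_divide_0[OF tendsto_const] filterlim_at_top_imp_at_infinity
            filterlim_real_sequentially)
    then have "(\<lambda>n. of_real (1 - u / real n) powr (b - 1)) \<longlonglongrightarrow> complex_of_real (1 - 0) powr (b - 1)"
      by (intro tendsto_intros) (auto simp: complex_nonpos_Reals_iff)
    ultimately have "(\<lambda>n. of_real u powr (a - 1) * (of_real (1 - u / real n) powr (b - 1) * of_real ((1 - u / n) ^ n)))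
       \<longlonglongrightarrow> of_real u powr (a - 1) * (complex_of_real (1 - 0) powr (b - 1) * of_real (exp (-u)))"
      by (intro tendsto_mult tendsto_of_real tendsto_const)
    then have "(\<lambda>n. of_real u powr (a - 1) * (of_real (1 - u / real n) powr (b - 1) * of_real ((1 - u / n) ^ n)))
       \<longlonglongrightarrow> of_real u powr (a - 1) / of_real (exp u)"
      by (simp add: exp_minus divide_inverse)
    moreover have "\<forall>\<^sub>F n in sequentially. u < real n"
      using filterlim_real_sequentially by (auto simp: filterlim_at_top_dense)
    then have "\<forall>\<^sub>F n in sequentially. of_real u powr (a - 1) * (of_real (1 - u / real n) powr (b - 1) * of_real ((1 - u / n) ^ n)) = f n u"
    proof eventually_elim
      case (elim n)
      then have "complex_of_real (1 - u / n) \<noteq> 0"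
        using u by (subst of_real_eq_0_iff) (auto simp: field_simps)
      moreover have "b + of_nat n - 1 = (b - 1) + of_nat n" by simp
      ultimately have "complex_of_real (1 - u / n) powr (b + of_nat n - 1) =
          of_real (1 - u / n) powr (b - 1) * of_real (1 - u / n) ^ n"
        by (simp only: powr_add powr_nat if_False)
      then show ?case using u elim by (simp add: f_def)
    qed
    ultimately show ?thesis by (rule Lim_transform_eventually)
  qed
  \<comment> \<open>The base is at most 1, so Re b > 0 may be dropped from the exponent. Then 1 - v
    \<le> exp (-v) gives the rate (n - 1) / n, which is at least 1/2 once n \<ge> 2; this is also
    why the sequence is shifted by 2 below.\<close>
  have bound: "norm (f n u) \<le> norm (of_real u powr (a - 1) / of_real (exp (1/2 * u)) :: complex)"
    if n: "n \<ge> 2" and u: "u \<in> {0<..}" for n u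
  proof (cases "u < real n")
    case True
    have pos: "0 < 1 - u / real n" using u n True by (auto simp: field_simps)
    have "norm (complex_of_real (1 - u / n) powr (b + of_nat n - 1)) = (1 - u / n) powr (Re b + (real n - 1))"
      using pos by (subst norm_of_real_powr) (auto simp: algebra_simps)
    also have "\<dots> \<le> (1 - u / n) powr (real n - 1)"
      using pos b u by (intro powr_mono') auto
    also have "\<dots> \<le> exp (- (u / n)) powr (real n - 1)"
      using pos n exp_ge_add_one_self[of "- (u / n)"] by (intro powr_mono2) auto
    also have "\<dots> = exp (- (u / n) * (real n - 1))"
      by (simp add: powr_def)
    also have "\<dots> \<le> exp (- (1/2 * u))"
      using n u by (auto simp: field_simps)
    finally have "norm (complex_of_real (1 - u / n) powr (b + of_nat n - 1)) \<le> exp (- (1/2 * u))" .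
    moreover have "norm (f n u) = norm (complex_of_real u powr (a - 1)) *
        norm (complex_of_real (1 - u / n) powr (b + of_nat n - 1))"
      using True u by (simp add: f_def norm_mult)
    moreover have "norm (of_real u powr (a - 1) / of_real (exp (1/2 * u)) :: complex) =
        norm (complex_of_real u powr (a - 1)) * exp (- (1/2 * u))"
      by (simp add: norm_divide exp_minus field_simps)
    ultimately show ?thesis by (simp add: mult_left_mono)
  qed (use u in \<open>auto simp: f_def\<close>)
  have dom: "(\<lambda>u. norm (of_real u powr (a - 1) / of_real (exp (1/2 * u)) :: complex)) integrable_on {0<..}"
    using absolutely_integrable_Gamma_integral[OF a, of "1/2"] unfolding absolutely_integrable_on_def by simp
  have "(\<lambda>n. integral {0<..} (f (n + 2))) \<longlonglongrightarrow> integral {0<..} (\<lambda>u. of_real u powr (a - 1) / of_real (exp u))"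
  proof (rule dominated_convergence(2)[OF _ dom])
    show "f (n + 2) integrable_on {0<..}" for n
      using f[of "n + 2"] by (simp add: has_integral_integrable del: of_nat_add)
    show "norm (f (n + 2) u) \<le> norm (of_real u powr (a - 1) / of_real (exp (1/2 * u)) :: complex)"
      if "u \<in> {0<..}" for n u
      using that by (intro bound) auto
    show "(\<lambda>n. f (n + 2) u) \<longlonglongrightarrow> of_real u powr (a - 1) / of_real (exp u)" if "u \<in> {0<..}" for u
      using lim[OF that] by (rule LIMSEQ_ignore_initial_segment)
  qed
  also have "integral {0<..} (\<lambda>u. of_real u powr (a - 1) / of_real (exp u)) = Gamma a"
    using Gamma_integral_complex'[OF a] by (rule integral_unique)
  finally have "(\<lambda>n. of_nat (n + 2) powr a * integral {0<..<1} (beta_integrand a (b + of_nat (n + 2)))) \<longlonglongrightarrow> Gamma a"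
    by (subst integral_unique[OF f, symmetric]) simp_all
  then show ?thesis by (rule LIMSEQ_offset)
qed

text \<open>The functional equation shifts \<open>b\<close> to \<open>b + n\<close> at the cost of a quotient of Pochhammer symbols;
  as \<open>n\<close> grows, the previous lemma and Euler's product for \<open>\<Gamma>\<close> identify the limit.\<close>
theorem has_integral_Beta_complex:
  assumes a: "Re a > 0" and b: "Re b > 0"
  shows "(beta_integrand a b has_integral Beta a b) {0<..<1}"
proof -
  let ?I = "\<lambda>b. integral {0<..<1} (beta_integrand a b)"
  have nz: "b + of_nat n \<notin> \<int>\<^sub>\<le>\<^sub>0" "a + b + of_nat n \<notin> \<int>\<^sub>\<le>\<^sub>0" for n
    using a b by (auto elim!: nonpos_Ints_cases simp: complex_eq_iff)
  have nz': "b + of_nat n \<noteq> 0" "a + b + of_nat n \<noteq> 0" for n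
    using nz[of n] by auto
  have I: "pochhammer (a + b) n * ?I (b + of_nat n) = pochhammer b n * ?I b" for n
  proof (induction n)
    case (Suc n)
    have "(a + b + of_nat n) * ?I (b + of_nat (Suc n)) = (b + of_nat n) * ?I (b + of_nat n)"
      using integral_beta_integrand_plus1[of a "b + of_nat n"] a b by (simp add: add_ac)
    then have "pochhammer (a + b) (Suc n) * ?I (b + of_nat (Suc n)) =
        (b + of_nat n) * (pochhammer (a + b) n * ?I (b + of_nat n))"
      by (simp add: pochhammer_Suc mult_ac)
    then show ?case by (simp add: Suc.IH pochhammer_Suc mult_ac)
  qed simp
  have Gamma_nz: "Gamma (a + b) \<noteq> 0"
    using nz(2)[of 0] by (simp add: Gamma_eq_zero_iff)
  have "(\<lambda>n. Gamma_series' b n / Gamma_series' (a + b) n * (of_nat n powr a * ?I (b + of_nat n)))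
      \<longlonglongrightarrow> Gamma b / Gamma (a + b) * Gamma a"
    by (intro tendsto_mult tendsto_divide Gamma_series'_LIMSEQ integral_beta_integrand_asymp a b Gamma_nz)
  moreover have "\<forall>\<^sub>F n in sequentially.
      Gamma_series' b n / Gamma_series' (a + b) n * (of_nat n powr a * ?I (b + of_nat n)) = ?I b"
    using eventually_gt_at_top[of 0]
  proof eventually_elim
    case (elim n)
    have p: "pochhammer b n \<noteq> 0" "pochhammer (a + b) n \<noteq> 0"
      using nz' by (auto simp: pochhammer_eq_0_iff eq_neg_iff_add_eq_0)
    \<comment> \<open>The factorials cancel, and the exponentials leave n to the power -a, which
      cancels \<open>of_nat n powr a\<close>. Only the Pochhammer symbols remain.\<close>
    have "Gamma_series' b n / Gamma_series' (a + b) n * of_nat n powr a = pochhammer (a + b) n / pochhammer b n"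
      using elim p by (simp add: Gamma_series'_def powr_def field_simps flip: exp_add)
    then have "Gamma_series' b n / Gamma_series' (a + b) n * (of_nat n powr a * ?I (b + of_nat n)) =
        pochhammer (a + b) n * ?I (b + of_nat n) / pochhammer b n"
      by (simp flip: mult.assoc)
    then show ?case using p by (simp add: I)
  qed
  \<comment> \<open>The convergent sequence is eventually constant, so its constant value is the
    limit.\<close>
  ultimately have "(\<lambda>n::nat. ?I b) \<longlonglongrightarrow> Gamma b / Gamma (a + b) * Gamma a"
    by (rule Lim_transform_eventually)
  then have "?I b = Gamma b / Gamma (a + b) * Gamma a"
    by (simp add: LIMSEQ_const_iff)
  then show ?thesis
    using integrable_integral[OF integrable_beta_integrand[OF a b]] by (simp add: Beta_def mult_ac)
qed

subsection \<open>Convergence of the Mittag-Leffler series\<close>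

text \<open>Inside the unit interval the power of t in the Beta integrand tends to 0, and as soon as
  the first argument is at least 1 the integrand is dominated by
  \<open>(1 - t) powr (b - 1)\<close>.\<close>

lemma Beta_tendsto_0:
  fixes b :: real
  assumes b: "b > 0" and X: "filterlim X at_top sequentially"
  shows "(\<lambda>n. Beta (X n) b) \<longlonglongrightarrow> 0"
proof -
  obtain N where N: "\<And>n. n \<ge> N \<Longrightarrow> X n \<ge> 1"
    using X by (auto simp: filterlim_at_top eventually_sequentially)
  define f where "f = (\<lambda>n t::real. t powr (X (n + N) - 1) * (1 - t) powr (b - 1))"
  have f: "(f n has_integral Beta (X (n + N)) b) {0<..<1}" for n
    using has_integral_Beta_real[of "X (n + N)" b] N[of "n + N"] b
    by (simp add: f_def has_integral_Icc_iff_Ioo)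
  have dom: "(\<lambda>t. (1 - t) powr (b - 1)) integrable_on {0<..<1::real}"
  proof -
    \<comment> \<open>Integrability of the majorant is read off from the Beta integral with first
      argument 1.\<close>
    have "((\<lambda>t. t powr (1 - 1) * (1 - t) powr (b - 1)) has_integral Beta 1 b) {0<..<1}"
      using has_integral_Beta_real[of 1 b] b by (simp add: has_integral_Icc_iff_Ioo)
    then have "((\<lambda>t. (1 - t) powr (b - 1)) has_integral Beta 1 b) {0<..<1}"
      by (rule has_integral_eq[rotated]) auto
    then show ?thesis by blast
  qed
  have lim: "(\<lambda>n. f n t) \<longlonglongrightarrow> 0" if t: "t \<in> {0<..<1}" for t
  proof -
    have "filterlim (\<lambda>n. (X (n + N) - 1) * ln t) at_bot sequentially"
    proof -
      have "filterlim (\<lambda>n. - 1 + X (n + N)) at_top sequentially"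
        by (intro filterlim_tendsto_add_at_top[OF tendsto_const]) (rule filterlim_compose[OF X filterlim_add_const_nat_at_top])
      then have "filterlim (\<lambda>n. ln t * (- 1 + X (n + N))) at_bot sequentially"
        using t by (intro filterlim_tendsto_neg_mult_at_bot[OF tendsto_const]) auto
      then show ?thesis by (simp add: algebra_simps)
    qed
    then have "(\<lambda>n. exp ((X (n + N) - 1) * ln t)) \<longlonglongrightarrow> 0"
      by (rule filterlim_compose[OF exp_at_bot])
    then have "(\<lambda>n. exp ((X (n + N) - 1) * ln t) * (1 - t) powr (b - 1)) \<longlonglongrightarrow> 0"
      by (rule tendsto_mult_left_zero)
    then show ?thesis using t by (simp add: f_def powr_def)
  qed
  have "(\<lambda>n. integral {0<..<1} (f n)) \<longlonglongrightarrow> integral {0<..<1} (\<lambda>t::real. 0)"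
  proof (rule dominated_convergence(2)[OF _ dom])
    show "f n integrable_on {0<..<1}" for n using f by blast
    show "norm (f n t) \<le> (1 - t) powr (b - 1)" if "t \<in> {0<..<1}" for n t
      using that N[of "n + N"] by (auto simp: f_def abs_mult intro!: mult_left_le_one_le powr_le1)
  qed (rule lim)
  then have "(\<lambda>n. Beta (X (n + N)) b) \<longlonglongrightarrow> 0"
    by (simp add: integral_unique[OF f])
  then show ?thesis by (rule LIMSEQ_offset)
qed

text \<open>Taking norms inside the complex Beta integral reduces decay estimates to real
  arguments.\<close>

lemma norm_Beta_le:
  assumes "Re a > 0" "Re b > 0"
  shows "norm (Beta a b) \<le> Beta (Re a) (Re b)"
proof -
  have "norm (integral {0<..<1} (beta_integrand a b)) \<le>
      integral {0<..<1} (\<lambda>t. t powr (Re a - 1) * (1 - t) powr (Re b - 1))"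
    using has_integral_Beta_real[OF assms]
    by (intro integral_norm_bound_integral integrable_beta_integrand assms)
       (auto simp: norm_beta_integrand has_integral_Icc_iff_Ioo)
  also have "\<dots> = Beta (Re a) (Re b)"
    using has_integral_Beta_real[OF assms] by (intro integral_unique) (simp add: has_integral_Icc_iff_Ioo)
  finally show ?thesis by (simp add: integral_unique[OF has_integral_Beta_complex[OF assms]])
qed

lemma Gamma_nonzero_if_Re_pos: "Re z > 0 \<Longrightarrow> Gamma z \<noteq> 0"
  by (auto simp: Gamma_eq_zero_iff elim!: nonpos_Ints_cases)

text \<open>The ratio of consecutive coefficients contains
  \<open>\<Gamma>(\<alpha>n + \<beta>) / \<Gamma>(\<alpha>n + \<beta> + \<alpha>) = B(\<alpha>n + \<beta>, \<alpha>) / \<Gamma>(\<alpha>)\<close>, which tends to 0.\<close>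
lemma summable_mittag_leffler3:
  assumes \<alpha>: "Re \<alpha> > 0"
  shows "summable (\<lambda>n. pochhammer \<gamma> n / (Gamma (\<alpha> * of_nat n + \<beta>) * fact n) * z ^ n)"
proof -
  define c where "c = (\<lambda>n. pochhammer \<gamma> n / (Gamma (\<alpha> * of_nat n + \<beta>) * fact n) * z ^ n)"
  \<comment> \<open>\<open>r\<close> is the quotient of consecutive terms. It is used only once Re
    (\<alpha> n + \<beta>) > 0, where the Gamma values are nonzero; before that a pole of Gamma,
    with value 0, could break the recurrence.\<close>
  define r where "r = (\<lambda>n. (\<gamma> + of_nat n) / of_nat (Suc n) * z * (Beta (\<alpha> * of_nat n + \<beta>) \<alpha> / Gamma \<alpha>))"
  have X: "filterlim (\<lambda>n. Re (\<alpha> * of_nat n + \<beta>)) at_top sequentially"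
    proof -
    have "filterlim (\<lambda>n. Re \<beta> + Re \<alpha> * real n) at_top sequentially"
      using \<alpha> by (intro filterlim_tendsto_add_at_top[OF tendsto_const]
          filterlim_tendsto_pos_mult_at_top[OF tendsto_const] filterlim_real_sequentially)
    then show ?thesis by (simp add: add.commute)
  qed
  have "\<forall>\<^sub>F n in sequentially. Re (\<alpha> * of_nat n + \<beta>) > 0"
    using X by (simp add: filterlim_at_top_dense)
  then have step: "\<forall>\<^sub>F n in sequentially. c (Suc n) = r n * c n"
  proof eventually_elim
    case (elim n)
    have nz: "Gamma \<alpha> \<noteq> 0" "Gamma (\<alpha> * of_nat n + \<beta>) \<noteq> 0"
      using \<alpha> elim by (intro Gamma_nonzero_if_Re_pos; simp)+
    have "\<alpha> * of_nat (Suc n) + \<beta> = \<alpha> + (\<alpha> * of_nat n + \<beta>)"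
      by (simp add: algebra_simps)
    then show ?case using nz
      by (simp add: c_def r_def Beta_def pochhammer_Suc add_ac mult_ac del: of_nat_Suc)
  qed
  have "(\<lambda>n. Beta (\<alpha> * of_nat n + \<beta>) \<alpha>) \<longlonglongrightarrow> 0"
  proof (rule Lim_null_comparison)
    show "(\<lambda>n. Beta (Re (\<alpha> * of_nat n + \<beta>)) (Re \<alpha>)) \<longlonglongrightarrow> 0"
      using \<alpha> X by (rule Beta_tendsto_0)
    show "\<forall>\<^sub>F n in sequentially. norm (Beta (\<alpha> * of_nat n + \<beta>) \<alpha>) \<le> Beta (Re (\<alpha> * of_nat n + \<beta>)) (Re \<alpha>)"
      using \<open>\<forall>\<^sub>F n in sequentially. Re (\<alpha> * of_nat n + \<beta>) > 0\<close>
      by eventually_elim (intro norm_Beta_le \<alpha>)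
  qed
  moreover have "(\<lambda>n. (\<gamma> + of_nat n) / of_nat (Suc n)) \<longlonglongrightarrow> 1"
  proof -
    have "(\<lambda>n. 1 + (\<gamma> - 1) * of_real (inverse (real (Suc n)))) \<longlonglongrightarrow> 1 + (\<gamma> - 1) * of_real 0"
      by (intro tendsto_intros LIMSEQ_inverse_real_of_nat)
    moreover have "(\<gamma> + of_nat n) / of_nat (Suc n) = 1 + (\<gamma> - 1) * of_real (inverse (real (Suc n)))" for n
      using of_nat_neq_0[of n, where 'a = complex] by (simp add: field_simps)
    ultimately show ?thesis by simp
  qed
  ultimately have "r \<longlonglongrightarrow> 1 * z * (0 / Gamma \<alpha>)"
    unfolding r_def divide_inverse[of "Beta _ _"] divide_inverse[of 0] by (intro tendsto_intros)
  then have "r \<longlonglongrightarrow> 0" by simp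
  then have "\<forall>\<^sub>F n in sequentially. norm (r n) < 1/2"
    by (rule order_tendstoD(2)[OF tendsto_norm_zero]) simp
  with step have "\<forall>\<^sub>F n in sequentially. norm (c (Suc n)) \<le> 1/2 * norm (c n)"
    by eventually_elim (simp only: norm_mult, intro mult_right_mono, auto)
  then obtain N where "\<And>n. n \<ge> N \<Longrightarrow> norm (c (Suc n)) \<le> 1/2 * norm (c n)"
    by (auto simp: eventually_sequentially)
  then have "summable c"
    by (intro summable_ratio_test[of "1/2" N]) auto
  then show ?thesis unfolding c_def .
qed

lemma isCont_mittag_leffler3:
  assumes "Re \<alpha> > 0"
  shows "isCont (mittag_leffler3 \<alpha> \<beta> \<gamma>) z"
proof -
  have "isCont (\<lambda>z. \<Sum>n. pochhammer \<gamma> n / (Gamma (\<alpha> * of_nat n + \<beta>) * fact n) * z ^ n) z"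
    using summable_mittag_leffler3[OF assms] by (rule isCont_powser_converges_everywhere)
  also have "(\<lambda>z. \<Sum>n. pochhammer \<gamma> n / (Gamma (\<alpha> * of_nat n + \<beta>) * fact n) * z ^ n) = mittag_leffler3 \<alpha> \<beta> \<gamma>"
    by (simp add: mittag_leffler3_def fun_eq_iff)
  finally show ?thesis .
qed

subsection \<open>Improper Henstock--Kurzweil integrals\<close>

text \<open>The definition of the integral over an unbounded set uses all intervals containing a
  large ball. Such an interval starts to the left of \<open>a\<close>, so its intersection with the
  half-line depends on the upper endpoint only. This form covers conditional convergence.\<close>

lemma has_integral_atLeast_iff:
  fixes f :: "real \<Rightarrow> 'a :: banach"
  shows "(f has_integral l) {a..} \<longleftrightarrow>
    (\<forall>b. f integrable_on {a..b}) \<and> ((\<lambda>b. integral {a..b} f) \<longlongrightarrow> l) at_top"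
proof -
  have Int: "{a..} \<inter> {c..d} = {max a c..d}" "{c..d} \<inter> {a..} = {max a c..d}" for c d by auto
  have 1: "(\<forall>c d. f integrable_on {max a c..d}) \<longleftrightarrow> (\<forall>b. f integrable_on {a..b})"
  proof (intro iffI allI)
    fix b assume "\<forall>c d. f integrable_on {max a c..d}"
    then show "f integrable_on {a..b}" by (metis max.idem)
  next
    fix c d assume "\<forall>b. f integrable_on {a..b}"
    then have "f integrable_on {a..d}" by blast
    then show "f integrable_on {max a c..d}"
      by (rule integrable_on_subinterval) auto
  qed
  have 2: "(\<forall>e>0. \<exists>B>0. \<forall>c d. ball 0 B \<subseteq> {c..d} \<longrightarrow> norm (integral {max a c..d} f - l) < e) \<longleftrightarrow>
      ((\<lambda>b. integral {a..b} f) \<longlongrightarrow> l) at_top"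
  proof
    assume L: "\<forall>e>0. \<exists>B>0. \<forall>c d. ball 0 B \<subseteq> {c..d} \<longrightarrow> norm (integral {max a c..d} f - l) < e"
    show "((\<lambda>b. integral {a..b} f) \<longlongrightarrow> l) at_top"
    proof (rule tendstoI)
      fix e :: real assume "e > 0"
      with L obtain B where B: "B > 0"
        "\<And>c d. ball 0 B \<subseteq> {c..d} \<Longrightarrow> norm (integral {max a c..d} f - l) < e" by blast
      show "\<forall>\<^sub>F b in at_top. dist (integral {a..b} f) l < e"
        using eventually_ge_at_top[of "max B \<bar>a\<bar>"]
      proof eventually_elim
        case (elim b)
        then have "max a (- b) = a" "ball 0 B \<subseteq> {-b..b}" by auto
        then show ?case using B(2)[of "-b" b] by (simp add: dist_norm)
      qed
    qed
  next
    assume R: "((\<lambda>b. integral {a..b} f) \<longlongrightarrow> l) at_top"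
    show "\<forall>e>0. \<exists>B>0. \<forall>c d. ball 0 B \<subseteq> {c..d} \<longrightarrow> norm (integral {max a c..d} f - l) < e"
    proof (intro allI impI)
      fix e :: real assume "e > 0"
      from tendstoD[OF R this] obtain N where N: "\<And>b. b \<ge> N \<Longrightarrow> dist (integral {a..b} f) l < e"
        by (auto simp: eventually_at_top_linorder)
      show "\<exists>B>0. \<forall>c d. ball 0 B \<subseteq> {c..d} \<longrightarrow> norm (integral {max a c..d} f - l) < e"
      \<comment> \<open>The radius is large enough for the ball to contain both \<open>N\<close> and
        \<open>a\<close>, which forces c \<le> a and N \<le> d.\<close>
      proof (intro exI[of _ "\<bar>N\<bar> + \<bar>a\<bar> + 1"] conjI allI impI)
        fix c d :: real assume "ball 0 (\<bar>N\<bar> + \<bar>a\<bar> + 1) \<subseteq> {c..d}"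
        moreover have "N \<in> ball 0 (\<bar>N\<bar> + \<bar>a\<bar> + 1)" "a \<in> ball 0 (\<bar>N\<bar> + \<bar>a\<bar> + 1)" by auto
        ultimately have "N \<in> {c..d}" "a \<in> {c..d}" by blast+
        then have "N \<le> d" "max a c = a" by auto
        then show "norm (integral {max a c..d} f - l) < e" using N[of d] by (simp add: dist_norm)
      qed auto
    qed
  qed
  show ?thesis
    unfolding has_integral_alt' box_real integrable_restrict_Int integral_restrict_Int Int 1 2 ..
qed

lemma has_integral_greaterThan_iff:
  fixes f :: "real \<Rightarrow> 'a :: banach"
  shows "(f has_integral l) {a<..} \<longleftrightarrow> (f has_integral l) {a..}"
  by (rule has_integral_spike_set_eq) (auto intro: negligible_subset[of "{a}"])

text \<open>The fundamental theorem on [a, b], which asks for derivatives in the interior only,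
  followed by b tending to infinity.\<close>

lemma has_integral_improper:
  fixes f K :: "real \<Rightarrow> 'a :: banach"
  assumes "continuous_on {a..} K" "\<And>p. p > a \<Longrightarrow> (K has_vector_derivative f p) (at p)"
    and "(K \<longlongrightarrow> l) at_top"
  shows "(f has_integral l - K a) {a<..}"
proof -
  have I: "(f has_integral K b - K a) {a..b}" if "b \<ge> a" for b
    using assms that by (intro fundamental_theorem_of_calculus_interior) (auto intro: continuous_on_subset)
  have "\<forall>\<^sub>F b in at_top. K b - K a = integral {a..b} f"
    using eventually_ge_at_top[of a] by eventually_elim (simp add: integral_unique[OF I])
  then have "((\<lambda>b. integral {a..b} f) \<longlongrightarrow> l - K a) at_top"
    by (rule Lim_transform_eventually[rotated]) (intro tendsto_intros assms)
  moreover have "f integrable_on {a..b}" for b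
    using I[of b] by (cases "a \<le> b") auto
  ultimately show ?thesis
    by (simp add: has_integral_greaterThan_iff has_integral_atLeast_iff)
qed

lemma tendsto_bounded_on_atLeast:
  fixes F :: "real \<Rightarrow> 'a :: real_normed_vector"
  assumes "continuous_on {a..} F" "(F \<longlongrightarrow> L) at_top"
  obtains M where "\<And>u. u \<ge> a \<Longrightarrow> norm (F u) \<le> M"
proof -
  obtain N where N: "\<And>u. u \<ge> N \<Longrightarrow> dist (F u) L < 1"
    using tendstoD[OF assms(2), of 1] by (auto simp: eventually_at_top_linorder)
  have "bounded (F ` {a..N})"
    using assms(1) by (intro compact_imp_bounded compact_continuous_image) (auto intro: continuous_on_subset)
  then obtain C where C: "\<And>u. u \<in> {a..N} \<Longrightarrow> norm (F u) \<le> C"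
    unfolding bounded_iff by blast
  show thesis
  proof (rule that[of "max C (norm L + 1)"])
    fix u assume u: "u \<ge> a"
    show "norm (F u) \<le> max C (norm L + 1)"
    proof (cases "u \<ge> N")
      case True
      then show ?thesis using N[OF True] norm_triangle_ineq2[of "F u" L] by (auto simp: dist_norm)
    next
      case False
      then show ?thesis using C[of u] u by auto
    qed
  qed
qed

subsection \<open>The Mellin transform for a conditionally integrable kernel\<close>

text \<open>What the argument uses of the Mittag-Leffler function: \<open>F\<close> is the primitive
  of \<open>u powr (s - 1) * E u\<close> starting at 0, and \<open>L\<close> is the value of the
  improper integral.\<close>

locale mellin_kernel =
  fixes E F :: "real \<Rightarrow> complex" and s L :: complex and M :: real
  assumes continuous_E: "continuous_on {0<..} E"
    and continuous_F: "continuous_on {0..} F"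
    and F_0: "F 0 = 0"
    and F_deriv: "\<And>u. u > 0 \<Longrightarrow> (F has_vector_derivative of_real u powr (s - 1) * E u) (at u)"
    and F_bound: "\<And>u. u \<ge> 0 \<Longrightarrow> norm (F u) \<le> M"
    and F_lim: "(F \<longlongrightarrow> L) at_top"
begin

lemma M_nonneg: "M \<ge> 0"
  using F_bound[of 0] norm_ge_zero[of "F 0"] by linarith

text \<open>For \<open>a = x + s\<close> and \<open>b = y + s\<close> this is \<open>p powr (s - 1)\<close> times the integrand of the generalized
  beta function, written as the \<open>p\<close>-derivative of \<open>t powr (a - 1) * (1 - t) powr (b - 1) * F (p / (t * (1 - t)))\<close>.\<close>
definition G :: "complex \<Rightarrow> complex \<Rightarrow> real \<Rightarrow> real \<Rightarrow> complex" where
  "G a b p t = beta_integrand a b t / of_real (t * (1 - t)) *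
     (of_real (p / (t * (1 - t))) powr (s - 1) * E (p / (t * (1 - t))))"

lemma continuous_F_comp:
  "continuous_on A f \<Longrightarrow> (\<And>t. t \<in> A \<Longrightarrow> f t \<ge> 0) \<Longrightarrow> continuous_on A (\<lambda>t. F (f t))"
  by (rule continuous_on_compose2[OF continuous_F]) auto

lemma F_quotient_deriv:
  assumes "p > 0" "t \<in> {0<..<1}"
  shows "((\<lambda>t. F (p / (t * (1 - t)))) has_vector_derivative
     of_real (- (p * (1 - 2 * t) / (t * (1 - t))\<^sup>2)) *
     (of_real (p / (t * (1 - t))) powr (s - 1) * E (p / (t * (1 - t))))) (at t)"
proof -
  have "((\<lambda>t. p / (t * (1 - t))) has_real_derivative - (p * (1 - 2 * t) / (t * (1 - t))\<^sup>2)) (at t)"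
    using assms by (auto intro!: derivative_eq_intros simp: power2_eq_square divide_simps) (simp add: algebra_simps)?
  then have "((\<lambda>t. p / (t * (1 - t))) has_vector_derivative - (p * (1 - 2 * t) / (t * (1 - t))\<^sup>2)) (at t)"
    by (simp add: has_real_derivative_iff_has_vector_derivative)
  from vector_diff_chain_at[OF this F_deriv] show ?thesis
    using assms by (simp add: o_def scaleR_conv_of_real)
qed

text \<open>Integration by parts against \<open>F (p / (t * (1 - t)))\<close>. The other factor acquires the denominator \<open>1 - 2 * t\<close>,
  hence the restriction to \<open>\<delta> \<le> 1/4\<close>.\<close>
lemma G_tail:
  assumes a: "Re a > 0"
  shows "\<exists>C\<ge>0. \<forall>\<delta> p. 0 < \<delta> \<longrightarrow> \<delta> \<le> 1/4 \<longrightarrow> p > 0 \<longrightarrow>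
    G a b p integrable_on {0..\<delta>} \<and> norm (integral {0..\<delta>} (G a b p)) \<le> C * \<delta> powr Re a / p"
proof -
  \<comment> \<open>\<open>h\<close> is the factor for which \<open>h\<close> times the t-derivative
    of F (p / (t (1 - t))) equals -p \<open>G\<close>. Its derivative is \<open>h'\<close>. Since
    \<open>m\<close> and \<open>k\<close> are continuous up to 0, \<open>h\<close> is O(t^a) and
    \<open>h'\<close> is O(t^(a - 1)), the latter integrable because Re a > 0.\<close>
  define m where "m = (\<lambda>t. complex_of_real (1 - t) powr b / of_real (1 - 2 * t))"
  define m' where "m' = (\<lambda>t. - b * complex_of_real (1 - t) powr (b - 1) / of_real (1 - 2 * t)
      + 2 * complex_of_real (1 - t) powr b / (of_real (1 - 2 * t))\<^sup>2)"
  define k where "k = (\<lambda>t. a * m t + of_real t * m' t)"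
  define h where "h = (\<lambda>t. complex_of_real t powr a * m t)"
  define h' where "h' = (\<lambda>t. complex_of_real t powr (a - 1) * k t)"
  have half: "1 - 2 * t > 0" "1 - t > 0" if "t \<in> {0..1/4}" for t :: real using that by auto
  have ne: "complex_of_real (1 - 2 * t) \<noteq> 0" if "t \<in> {0..1/4}" for t :: real
    using half[OF that] by (subst of_real_eq_0_iff) auto
  have cm: "continuous_on {0..1/4} m" unfolding m_def
    by (intro continuous_on_divide continuous_on_of_real_powr_complex continuous_intros ballI ne half; assumption?)
  have cm': "continuous_on {0..1/4} m'" unfolding m'_def
    by (intro continuous_on_add continuous_on_mult continuous_on_divide continuous_on_of_real_powr_complex continuous_intros ballI ne half power_not_zero; assumption?)
  have ck: "continuous_on {0..1/4} k" unfolding k_def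
    by (intro continuous_intros cm cm')
  have "bounded (m ` {0..1/4})" "bounded (k ` {0..1/4})"
    by (intro compact_imp_bounded compact_continuous_image cm ck compact_Icc)+
  then obtain C1 C2 where C12: "\<And>t. t \<in> {0..1/4} \<Longrightarrow> norm (m t) \<le> C1" "\<And>t. t \<in> {0..1/4} \<Longrightarrow> norm (k t) \<le> C2"
    unfolding bounded_iff by blast
  define C where "C = max 0 (max C1 C2)"
  have C: "C \<ge> 0" "\<And>t. t \<in> {0..1/4} \<Longrightarrow> norm (m t) \<le> C" "\<And>t. t \<in> {0..1/4} \<Longrightarrow> norm (k t) \<le> C"
    using C12 unfolding C_def by fastforce+
  have hb: "norm (h t) \<le> C * t powr Re a" if "t \<in> {0..1/4}" for t
    using C(2)[OF that] that by (simp add: h_def norm_mult norm_powr_real_powr mult.commute mult_right_mono)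
  have h'b: "norm (h' t) \<le> C * t powr (Re a - 1)" if "t \<in> {0..1/4}" for t
    using C(3)[OF that] that by (simp add: h'_def norm_mult norm_powr_real_powr mult.commute mult_right_mono)
  have hd: "(h has_vector_derivative h' t) (at t)" if t: "t \<in> {0<..<1/4}" for t
  proof -
    have "((\<lambda>z. z powr a * ((1 - z) powr b / (1 - 2 * z))) has_field_derivative
       h' t) (at (complex_of_real t))"
    proof -
      have n: "1 - 2 * complex_of_real t \<noteq> 0" using ne[of t] t by simp
      have t0: "complex_of_real t \<noteq> 0" using t by simp
      have alg: "(- b * Q * d - P * (- 2)) / (d * d) = - b * Q / d + 2 * P / d\<^sup>2"
        if "d \<noteq> 0" for d P Q :: complex
        using that by (simp add: field_simps power2_eq_square)
      have "((\<lambda>z. (1 - z) powr b) has_field_derivative - b * (1 - of_real t) powr (b - 1)) (at (complex_of_real t))"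
        using t by (auto intro!: derivative_eq_intros simp: complex_nonpos_Reals_iff)
      moreover have "((\<lambda>z. 1 - 2 * z) has_field_derivative - 2) (at (complex_of_real t))"
        by (auto intro!: derivative_eq_intros)
      ultimately have "((\<lambda>z. (1 - z) powr b / (1 - 2 * z)) has_field_derivative
          - b * (1 - of_real t) powr (b - 1) / (1 - 2 * of_real t) + 2 * (1 - of_real t) powr b / (1 - 2 * of_real t)\<^sup>2)
          (at (complex_of_real t))"
        by (subst alg[OF n, symmetric], intro DERIV_divide n)
      also have "- b * (1 - of_real t) powr (b - 1) / (1 - 2 * of_real t) + 2 * (1 - of_real t) powr b / (1 - 2 * of_real t)\<^sup>2 = m' t"
        by (simp add: m'_def)
      finally have dm: "((\<lambda>z. (1 - z) powr b / (1 - 2 * z)) has_field_derivative m' t) (at (complex_of_real t))" .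
      have "((\<lambda>z. z powr a) has_field_derivative a * of_real t powr (a - 1)) (at (complex_of_real t))"
        using t by (auto intro!: derivative_eq_intros simp: complex_nonpos_Reals_iff)
      from DERIV_mult'[OF this dm]
      have "((\<lambda>z. z powr a * ((1 - z) powr b / (1 - 2 * z))) has_field_derivative
       (of_real t powr a * m' t + (a * of_real t powr (a - 1)) * m t)) (at (complex_of_real t))"
        by (simp add: m_def)
      also have "of_real t powr a * m' t + (a * of_real t powr (a - 1)) * m t = h' t"
        using t0 by (simp add: h'_def k_def powr_diff algebra_simps)
      finally show ?thesis .
    qed
    from has_vector_derivative_real_field[OF this] show ?thesis
      by (simp add: h_def m_def)
  qed
  \<comment> \<open>In the constant, \<open>M * C / Re a\<close> comes from integrating
    \<open>h' * \<Phi>\<close> and \<open>M * C\<close> from the boundary term at \<delta>.\<close>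
  have bound: "G a b p integrable_on {0..\<delta>} \<and>
      norm (integral {0..\<delta>} (G a b p)) \<le> (M * C / Re a + M * C) * \<delta> powr Re a / p"
    if \<delta>: "0 < \<delta>" "\<delta> \<le> 1/4" and p: "p > 0" for \<delta> p
  proof -
    define \<Phi> where "\<Phi> = (\<lambda>t. F (p / (t * (1 - t))))"
    have \<Phi>b: "norm (\<Phi> t) \<le> M" if "t \<in> {0..1/4}" for t
      using that p unfolding \<Phi>_def by (intro F_bound) auto
    have c\<Phi>: "continuous_on {0<..\<delta>} \<Phi>" unfolding \<Phi>_def
      using p \<delta> by (intro continuous_F_comp continuous_intros) auto
    have ch: "continuous_on {0<..\<delta>} h" unfolding h_def
      using \<delta> by (intro continuous_on_mult continuous_on_of_real_powr_complex continuous_intros continuous_on_subset[OF cm]) auto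
    have hG: "h t * (of_real (- (p * (1 - 2 * t) / (t * (1 - t))\<^sup>2)) *
     (of_real (p / (t * (1 - t))) powr (s - 1) * E (p / (t * (1 - t))))) = - of_real p * G a b p t"
      if t: "t \<in> {0<..<1/4}" for t
    proof -
      have "h t * of_real (- (p * (1 - 2 * t) / (t * (1 - t))\<^sup>2)) =
          - of_real p * (beta_integrand a b t / of_real (t * (1 - t)))"
        using t ne[of t] half[of t] by (simp add: h_def m_def beta_integrand_def of_real_powr_minus_1 del: of_real_diff)
           (simp add: field_simps power2_eq_square)
      then show ?thesis by (simp only: G_def mult.assoc [symmetric])
    qed
    have "((\<lambda>t. h' t * \<Phi> t - of_real p * G a b p t) has_integral h \<delta> * \<Phi> \<delta> - h 0 * \<Phi> 0) {0..\<delta>}"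
    proof (rule fundamental_theorem_of_calculus_interior)
      show "continuous_on {0..\<delta>} (\<lambda>t. h t * \<Phi> t)"
        unfolding continuous_on_eq_continuous_within
      proof
        fix t assume t: "t \<in> {0..\<delta>}"
        show "continuous (at t within {0..\<delta>}) (\<lambda>t. h t * \<Phi> t)"
        proof (cases "t = 0")
          case True
          \<comment> \<open>Here p / 0 = 0, so \<open>\<Phi> 0\<close> is F 0 and need not be the
            limit of \<Phi>. Continuity of the product at 0 comes from \<open>h\<close> tending to 0
            while \<Phi> stays bounded.\<close>
          have "((\<lambda>t. h t * \<Phi> t) \<longlongrightarrow> 0) (at 0 within {0..\<delta>})"
          proof (rule Lim_null_comparison)
            show "\<forall>\<^sub>F t in at 0 within {0..\<delta>}. norm (h t * \<Phi> t) \<le> C * t powr Re a * M"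
              unfolding eventually_at_filter using \<delta> C M_nonneg
              by (auto intro!: always_eventually mult_mono hb \<Phi>b simp: norm_mult)
            have "continuous_on {0..\<delta>} (\<lambda>t. C * t powr Re a * M)"
              using a by (intro continuous_on_mult continuous_on_powr' continuous_on_const continuous_on_id) auto
            then show "((\<lambda>t. C * t powr Re a * M) \<longlongrightarrow> 0) (at 0 within {0..\<delta>})"
              using \<delta> by (force simp: continuous_on_def)
          qed
          then show ?thesis using True by (simp add: continuous_within h_def)
        next
          case False
          then have "continuous (at t within {0<..\<delta>}) (\<lambda>t. h t * \<Phi> t)"
            using t continuous_on_mult[OF ch c\<Phi>] by (auto simp: continuous_on_eq_continuous_within)
          moreover have "at t within {0<..\<delta>} = at t within {0..\<delta>}"
            using t False by (intro at_within_nhd[of t "{0<..}"]) auto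
          ultimately show ?thesis by simp
        qed
      qed
      show "((\<lambda>t. h t * \<Phi> t) has_vector_derivative h' t * \<Phi> t - of_real p * G a b p t) (at t)"
        if t: "t \<in> {0<..<\<delta>}" for t
      proof -
        have "((\<lambda>t. h t * \<Phi> t) has_vector_derivative h t * (of_real (- (p * (1 - 2 * t) / (t * (1 - t))\<^sup>2)) *
           (of_real (p / (t * (1 - t))) powr (s - 1) * E (p / (t * (1 - t))))) + h' t * \<Phi> t) (at t)"
          using t \<delta> p unfolding \<Phi>_def by (intro has_vector_derivative_mult hd F_quotient_deriv) auto
        then show ?thesis using t \<delta> by (subst (asm) hG) auto
      qed
    qed (use \<delta> in auto)
    then have 1: "((\<lambda>t. h' t * \<Phi> t - of_real p * G a b p t) has_integral h \<delta> * \<Phi> \<delta>) {0<..<\<delta>}"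
      by (simp add: h_def has_integral_Icc_iff_Ioo)
    have dom: "((\<lambda>t. C * t powr (Re a - 1) * M) has_integral C * (\<delta> powr Re a / Re a) * M) {0<..<\<delta>}"
      using has_integral_powr_from_0[of "Re a - 1" \<delta>] a \<delta>
      by (intro has_integral_mult_left has_integral_mult_right) (auto simp: has_integral_Icc_iff_Ioo)
    have hb2: "norm (h' t * \<Phi> t) \<le> C * t powr (Re a - 1) * M" if "t \<in> {0<..<\<delta>}" for t
      using that \<delta> C unfolding norm_mult by (intro mult_mono h'b \<Phi>b) auto
    have ai: "(\<lambda>t. h' t * \<Phi> t) absolutely_integrable_on {0<..<\<delta>}"
    proof (rule continuous_dominated_absolutely_integrable[OF _ _ _ hb2])
      show "continuous_on {0<..<\<delta>} (\<lambda>t. h' t * \<Phi> t)"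
        unfolding h'_def
        using \<delta> by (intro continuous_on_mult continuous_on_of_real_powr_complex continuous_intros
            continuous_on_subset[OF ck] continuous_on_subset[OF c\<Phi>]) auto
    qed (use dom in auto)
    then have int: "(\<lambda>t. h' t * \<Phi> t) integrable_on {0<..<\<delta>}"
      using set_lebesgue_integral_eq_integral(1) by blast
    define J where "J = integral {0<..<\<delta>} (\<lambda>t. h' t * \<Phi> t)"
    have J: "norm J \<le> C * (\<delta> powr Re a / Re a) * M"
      unfolding J_def integral_unique[OF dom, symmetric]
      using dom hb2 by (intro integral_norm_bound_integral int) auto
    \<comment> \<open>\<open>h' * \<Phi>\<close> is absolutely integrable, so subtracting the
      integrated product rule gives integrability of \<open>G\<close> together with its
      integral.\<close>
    have "((\<lambda>t. of_real p * G a b p t) has_integral J - h \<delta> * \<Phi> \<delta>) {0<..<\<delta>}"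
      using has_integral_diff[OF integrable_integral[OF int] 1] by (simp add: J_def)
    from has_integral_mult_right[OF this, of "1 / of_real p"]
    have I: "(G a b p has_integral (J - h \<delta> * \<Phi> \<delta>) / of_real p) {0..\<delta>}"
      using p by (simp add: has_integral_Icc_iff_Ioo)
    have "norm (h \<delta> * \<Phi> \<delta>) \<le> C * \<delta> powr Re a * M"
      unfolding norm_mult using \<delta> C by (intro mult_mono hb \<Phi>b) auto
    with J have "norm (J - h \<delta> * \<Phi> \<delta>) \<le> (M * C / Re a + M * C) * \<delta> powr Re a"
      using norm_triangle_ineq4[of J "h \<delta> * \<Phi> \<delta>"] by (simp add: algebra_simps)
    then have "norm ((J - h \<delta> * \<Phi> \<delta>) / of_real p) \<le> (M * C / Re a + M * C) * \<delta> powr Re a / p"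
      using p by (simp add: norm_divide divide_right_mono)
    with I show ?thesis
      by (auto simp: integral_unique)
  qed
  show ?thesis
    by (intro exI[of _ "M * C / Re a + M * C"] conjI allI impI bound[THEN conjunct1] bound[THEN conjunct2])
       (use M_nonneg C(1) a in simp_all)
qed

end

text \<open>Reflection in 1/2 carries the integral of \<open>g\<close> over the left half to that of
  \<open>f\<close> over the right half, so endpoint estimates are required at 0 only.\<close>

lemma has_integral_unit_interval_halves:
  fixes f g :: "real \<Rightarrow> 'a :: banach"
  assumes f: "(f has_integral i) {0..1/2}" and g: "(g has_integral j) {0..1/2}"
    and fg: "\<And>t. f (1 - t) = g t"
  shows "(f has_integral i + j) {0<..<1}"
proof -
  have "((\<lambda>t. g (-1 * t + 1)) has_integral j) {1/2..1}"
    using has_integral_affinity[of g j 0 "1/2" "-1" 1] g by simp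
  moreover have "g (-1 * t + 1) = f t" for t
    using fg[of "1 - t"] by (simp add: add.commute)
  ultimately have "(f has_integral j) {1/2..1}" by simp
  with f have "(f has_integral i + j) {0..1}"
    by (intro has_integral_combine[of 0 "1/2" 1]) auto
  then show ?thesis by (simp add: has_integral_Icc_iff_Ioo)
qed

lemma beta_integrand_reflect: "beta_integrand a b (1 - t) = beta_integrand b a t"
  by (simp add: beta_integrand_def mult.commute)

section \<open>The half-interval function K and its derivative in p\<close>

context mellin_kernel
begin

lemma G_reflect: "G a b p (1 - t) = G b a p t"
  by (simp add: G_def beta_integrand_reflect mult.commute)

definition K :: "complex \<Rightarrow> complex \<Rightarrow> real \<Rightarrow> complex" where
  "K a b p = integral {0..1/2} (\<lambda>t. beta_integrand a b t * F (p / (t * (1 - t))))"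

context
  fixes a b :: complex
  assumes a: "Re a > 0" and b: "Re b > 0"
begin

text \<open>A majorant independent of p, available because \<open>F\<close> is bounded by
  \<open>M\<close>.\<close>

lemma integrable_norm_beta_integrand_half:
  "(\<lambda>t. norm (beta_integrand a b t) * M) integrable_on {0<..<1/2}"
proof -
  have "beta_integrand a b absolutely_integrable_on {0<..<1/2}"
    by (rule set_integrable_subset[OF absolutely_integrable_beta_integrand[OF a b]]) auto
  then show ?thesis
    unfolding absolutely_integrable_on_def by (intro integrable_on_mult_left) auto
qed

lemma K_integrand_integrable:
  assumes "p \<ge> 0"
  shows "(\<lambda>t. beta_integrand a b t * F (p / (t * (1 - t)))) integrable_on {0<..<1/2}"
proof -
  have "(\<lambda>t. beta_integrand a b t * F (p / (t * (1 - t)))) absolutely_integrable_on {0<..<1/2}"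
  proof (rule continuous_dominated_absolutely_integrable[OF _ _ integrable_norm_beta_integrand_half])
    show "continuous_on {0<..<1/2} (\<lambda>t. beta_integrand a b t * F (p / (t * (1 - t))))"
      using assms by (intro continuous_on_mult continuous_on_subset[OF continuous_on_beta_integrand]
          continuous_F_comp continuous_intros) auto
    show "norm (beta_integrand a b t * F (p / (t * (1 - t)))) \<le> norm (beta_integrand a b t) * M"
      if "t \<in> {0<..<1/2}" for t
      using that assms unfolding norm_mult by (intro mult_left_mono F_bound) auto
  qed auto
  then show ?thesis using set_lebesgue_integral_eq_integral(1) by blast
qed

text \<open>The common dominated convergence step behind the continuity of \<open>K\<close> and its
  limit at infinity.\<close>

lemma K_tendsto:
  assumes X: "\<And>n. X n \<ge> 0"
    and lim: "\<And>t. t \<in> {0<..<1/2} \<Longrightarrow> (\<lambda>n. F (X n / (t * (1 - t)))) \<longlonglongrightarrow> \<Phi> t"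
  shows "(\<lambda>n. K a b (X n)) \<longlonglongrightarrow> integral {0..1/2} (\<lambda>t. beta_integrand a b t * \<Phi> t)"
  unfolding K_def integral_open_interval_real
proof (rule dominated_convergence(2)[OF _ integrable_norm_beta_integrand_half])
  show "norm (beta_integrand a b t * F (X n / (t * (1 - t)))) \<le> norm (beta_integrand a b t) * M"
    if "t \<in> {0<..<1/2}" for n t
    using that X unfolding norm_mult by (intro mult_left_mono F_bound) auto
qed (auto intro!: K_integrand_integrable X tendsto_mult lim)

lemma K_0: "K a b 0 = 0"
  by (simp add: K_def F_0)

lemma continuous_on_K: "continuous_on {0..} (K a b)"
  unfolding continuous_on_sequentially
proof (intro allI ballI impI)
  fix X :: "nat \<Rightarrow> real" and p :: real
  assume X: "p \<in> {0..}" "(\<forall>n. X n \<in> {0..}) \<and> X \<longlonglongrightarrow> p"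
  have "(\<lambda>n. K a b (X n)) \<longlonglongrightarrow> K a b p"
    unfolding K_def[of a b p]
  proof (rule K_tendsto)
    show "X n \<ge> 0" for n using X by auto
    fix t :: real assume t: "t \<in> {0<..<1/2}"
    show "(\<lambda>n. F (X n / (t * (1 - t)))) \<longlonglongrightarrow> F (p / (t * (1 - t)))"
      using X t by (intro continuous_on_tendsto_compose[OF continuous_F] tendsto_intros always_eventually) auto
  qed
  then show "(K a b \<circ> X) \<longlonglongrightarrow> K a b p" by (simp add: o_def)
qed

lemma K_at_top: "(K a b \<longlongrightarrow> L * integral {0..1/2} (beta_integrand a b)) at_top"
proof (rule tendsto_at_topI_sequentially)
  fix X :: "nat \<Rightarrow> real" assume X: "filterlim X at_top sequentially"
  \<comment> \<open>\<open>F\<close> is controlled on nonnegative arguments only, so the initial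
    terms of the sequence are cut off.\<close>
  then obtain N where N: "\<And>n. n \<ge> N \<Longrightarrow> X n \<ge> 0"
    by (auto simp: filterlim_at_top eventually_sequentially)
  have X': "filterlim (\<lambda>n. X (n + N)) at_top sequentially"
    by (rule filterlim_compose[OF X filterlim_add_const_nat_at_top])
  have "(\<lambda>n. K a b (X (n + N))) \<longlonglongrightarrow> integral {0..1/2} (\<lambda>t. beta_integrand a b t * L)"
  proof (rule K_tendsto)
    fix t :: real assume t: "t \<in> {0<..<1/2}"
    have "filterlim (\<lambda>n. inverse (t * (1 - t)) * X (n + N)) at_top sequentially"
      using t X' by (intro filterlim_tendsto_pos_mult_at_top[OF tendsto_const]) auto
    then show "(\<lambda>n. F (X (n + N) / (t * (1 - t)))) \<longlonglongrightarrow> L"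
      by (intro filterlim_compose[OF F_lim]) (simp add: divide_inverse mult.commute)
  qed (auto intro: N)
  then have "(\<lambda>n. K a b (X n)) \<longlonglongrightarrow> integral {0..1/2} (\<lambda>t. beta_integrand a b t * L)"
    by (rule LIMSEQ_offset)
  then show "(\<lambda>n. K a b (X n)) \<longlonglongrightarrow> L * integral {0..1/2} (beta_integrand a b)"
    by (simp add: mult.commute)
qed

lemma continuous_on_G:
  "continuous_on ({0<..} \<times> {0<..<1}) (\<lambda>(p, t). G a b p t)"
  unfolding G_def split_beta
proof (intro continuous_on_mult continuous_on_divide continuous_on_of_real_powr_complex)
  show "continuous_on ({0<..} \<times> {0<..<1}) (\<lambda>z. beta_integrand a b (snd z))"
    by (rule continuous_on_compose2[OF continuous_on_beta_integrand]) (auto intro!: continuous_intros)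
  show "continuous_on ({0<..} \<times> {0<..<1}) (\<lambda>z. E (fst z / (snd z * (1 - snd z))))"
    by (rule continuous_on_compose2[OF continuous_E]) (auto intro!: continuous_intros)
qed (auto intro!: continuous_intros)

lemma continuous_on_G_right:
  assumes "p > 0" "A \<subseteq> {0<..<1}"
  shows "continuous_on A (G a b p)"
proof -
  have "continuous_on A (\<lambda>t. case (p, t) of (p, t) \<Rightarrow> G a b p t)"
    using assms by (intro continuous_on_compose2[OF continuous_on_G] continuous_intros) auto
  then show ?thesis by simp
qed

text \<open>Near 0 this is the integration by parts of \<open>G_tail\<close> with \<delta> = 1/4; on
  the rest \<open>G\<close> is continuous.\<close>

lemma G_integrable:
  assumes "p > 0"
  shows "G a b p integrable_on {0..1/2}"
proof (rule Henstock_Kurzweil_Integration.integrable_combine)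
  show "G a b p integrable_on {0..1/4}"
    using G_tail[OF a, of b] assms by force
  show "G a b p integrable_on {1/4..1/2}"
    using assms by (intro integrable_continuous_interval continuous_on_G_right) auto
qed auto

text \<open>Cutting off at \<delta> n leaves integrals \<open>Kn\<close> to which the Leibniz rule
  applies. They converge pointwise to \<open>K\<close>, and by \<open>G_tail\<close> their
  derivatives converge uniformly near p0, so the limit may be differentiated termwise.\<close>

lemma has_vector_derivative_K:
  assumes p0: "p0 > 0"
  shows "(K a b has_vector_derivative integral {0..1/2} (G a b p0)) (at p0)"
proof -
  \<comment> \<open>The tail bound contains 1 / p; staying above p0 / 2 makes it uniform. The factor
    1/4 in \<open>\<delta>\<close> meets the restriction in \<open>G_tail\<close>.\<close>
  define S where "S = {p0 / 2 <..}"
  define \<delta> where "\<delta> = (\<lambda>n. inverse (real (Suc n)) / 4)"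
  have \<delta>: "0 < \<delta> n" "\<delta> n \<le> 1/4" for n by (auto simp: \<delta>_def divide_simps)
  have "\<delta> n \<in> {0..1/2}" for n using \<delta>[of n] by simp
  then have \<delta>_half: "\<forall>\<^sub>F n in sequentially. \<delta> n \<in> {0..1/2}"
    by (intro always_eventually allI)
  have \<delta>_lim: "\<delta> \<longlonglongrightarrow> 0"
    unfolding \<delta>_def by (rule tendsto_divide_zero[OF LIMSEQ_inverse_real_of_nat])
  define Kn where "Kn = (\<lambda>n p. integral {\<delta> n..1/2} (\<lambda>t. beta_integrand a b t * F (p / (t * (1 - t)))))"
  have S_pos: "p > 0" if "p \<in> S" for p using that p0 by (auto simp: S_def)
  have Kn_deriv: "(Kn n has_derivative (\<lambda>h. h *\<^sub>R integral {\<delta> n..1/2} (G a b p))) (at p within S)"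
    if p: "p \<in> S" for n p
    unfolding Kn_def has_vector_derivative_def[symmetric] box_real[symmetric]
  proof (rule leibniz_rule_vector_derivative)
    fix p t assume p: "p \<in> S" and "t \<in> cbox (\<delta> n) (1/2)"
    then have t: "t > 0" "t < 1" using \<delta>[of n] by auto
    have "((\<lambda>p. p / (t * (1 - t))) has_vector_derivative 1 / (t * (1 - t))) (at p)"
      unfolding has_real_derivative_iff_has_vector_derivative[symmetric]
      by (intro DERIV_cdivide DERIV_ident)
    from vector_diff_chain_at[OF this F_deriv]
    have "((\<lambda>p. F (p / (t * (1 - t)))) has_vector_derivative (1 / (t * (1 - t))) *\<^sub>R
        (of_real (p / (t * (1 - t))) powr (s - 1) * E (p / (t * (1 - t))))) (at p)"
      using t S_pos[OF p] by (simp add: o_def)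
    from has_vector_derivative_mult_right[OF this, of "beta_integrand a b t"]
    show "((\<lambda>p. beta_integrand a b t * F (p / (t * (1 - t)))) has_vector_derivative G a b p t) (at p within S)"
      by (rule has_vector_derivative_at_within[OF has_vector_derivative_eq_rhs])
         (simp add: G_def scaleR_conv_of_real)
  next
    fix p assume p: "p \<in> S"
    show "(\<lambda>t. beta_integrand a b t * F (p / (t * (1 - t)))) integrable_on cbox (\<delta> n) (1/2)"
      using \<delta>[of n] S_pos[OF p] unfolding box_real
      by (intro integrable_continuous_interval continuous_on_mult continuous_F_comp
           continuous_on_subset[OF continuous_on_beta_integrand] continuous_intros) auto
  next
    show "continuous_on (S \<times> cbox (\<delta> n) (1/2)) (\<lambda>(p, t). G a b p t)"
      using \<delta>[of n] S_pos by (intro continuous_on_subset[OF continuous_on_G]) auto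
  qed (use p in \<open>auto simp: S_def\<close>)
  have Kn_lim: "(\<lambda>n. Kn n p) \<longlonglongrightarrow> K a b p" if p: "p \<in> S" for p
  proof -
    define f where "f = (\<lambda>t. beta_integrand a b t * F (p / (t * (1 - t))))"
    have "f integrable_on {0..1/2}"
      using K_integrand_integrable[of p] S_pos[OF p] by (simp add: f_def integrable_on_Icc_iff_Ioo)
    \<comment> \<open>An indefinite integral is continuous in its lower limit, so the cutoff can be
      removed.\<close>
    then have "continuous_on {0..1/2} (\<lambda>x. integral {x..1/2} f)"
      by (rule indefinite_integral_continuous_1')
    then have "(\<lambda>n. integral {\<delta> n..1/2} f) \<longlonglongrightarrow> integral {0..1/2} f"
      by (rule continuous_on_tendsto_compose[OF _ \<delta>_lim _ \<delta>_half]) simp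
    then show ?thesis by (simp add: Kn_def K_def f_def)
  qed
  obtain C where C: "C \<ge> 0" "\<forall>\<delta> p. 0 < \<delta> \<longrightarrow> \<delta> \<le> 1/4 \<longrightarrow> p > 0 \<longrightarrow>
    G a b p integrable_on {0..\<delta>} \<and> norm (integral {0..\<delta>} (G a b p)) \<le> C * \<delta> powr Re a / p"
    using G_tail[OF a, of b] by blast
  have unif: "\<forall>\<^sub>F n in sequentially. \<forall>p\<in>S. \<forall>h. norm (h *\<^sub>R integral {\<delta> n..1/2} (G a b p) -
      h *\<^sub>R integral {0..1/2} (G a b p)) \<le> e * norm h" if e: "e > 0" for e
  proof -
    have "(\<lambda>n. C * \<delta> n powr Re a / (p0 / 2)) \<longlonglongrightarrow> C * 0 powr Re a / (p0 / 2)"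
      using a p0 \<delta> by (intro tendsto_divide tendsto_mult tendsto_const tendsto_powr' \<delta>_lim)
        (auto intro!: always_eventually less_imp_le)
    then have "\<forall>\<^sub>F n in sequentially. C * \<delta> n powr Re a / (p0 / 2) < e"
      using e by (intro order_tendstoD(2)) auto
    then show ?thesis
    proof eventually_elim
      case (elim n)
      show ?case
      proof safe
        fix p h assume p: "p \<in> S"
        have split: "integral {0..\<delta> n} (G a b p) + integral {\<delta> n..1/2} (G a b p) = integral {0..1/2} (G a b p)"
          using \<delta>[of n] by (intro Henstock_Kurzweil_Integration.integral_combine G_integrable S_pos p) auto
        \<comment> \<open>The error in the derivative is exactly the integral over the removed piece
          near 0.\<close>
        have "h *\<^sub>R integral {\<delta> n..1/2} (G a b p) - h *\<^sub>R integral {0..1/2} (G a b p) =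
            - (h *\<^sub>R integral {0..\<delta> n} (G a b p))"
          by (simp add: scaleR_right_distrib flip: split)
        then have "norm (h *\<^sub>R integral {\<delta> n..1/2} (G a b p) - h *\<^sub>R integral {0..1/2} (G a b p)) =
            norm (integral {0..\<delta> n} (G a b p)) * norm h" by simp
        also have "\<dots> \<le> e * norm h"
        proof (rule mult_right_mono)
          have "norm (integral {0..\<delta> n} (G a b p)) \<le> C * \<delta> n powr Re a / p"
            using C(2)[rule_format, of "\<delta> n" p] \<delta>[of n] S_pos[OF p] by simp
          also have "\<dots> \<le> C * \<delta> n powr Re a / (p0 / 2)"
            using p p0 C(1) by (intro divide_left_mono) (auto simp: S_def)
          finally show "norm (integral {0..\<delta> n} (G a b p)) \<le> e" using elim by simp
        qed auto
        finally show "norm (h *\<^sub>R integral {\<delta> n..1/2} (G a b p) - h *\<^sub>R integral {0..1/2} (G a b p)) \<le> e * norm h" .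
      qed
    qed
  qed
  have p0S: "p0 \<in> S" using p0 by (simp add: S_def)
  have "\<exists>g. \<forall>p\<in>S. (\<lambda>n. Kn n p) \<longlonglongrightarrow> g p \<and>
      (g has_derivative (\<lambda>h. h *\<^sub>R integral {0..1/2} (G a b p))) (at p within S)"
    by (rule has_derivative_sequence[OF _ Kn_deriv unif p0S Kn_lim[OF p0S]]) (auto simp: S_def)
  then obtain g where g: "\<And>p. p \<in> S \<Longrightarrow> (\<lambda>n. Kn n p) \<longlonglongrightarrow> g p"
      "\<And>p. p \<in> S \<Longrightarrow> (g has_derivative (\<lambda>h. h *\<^sub>R integral {0..1/2} (G a b p))) (at p within S)"
    by blast
  have "g p = K a b p" if "p \<in> S" for p
    by (rule LIMSEQ_unique[OF g(1)[OF that] Kn_lim[OF that]])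
  then have "(K a b has_derivative (\<lambda>h. h *\<^sub>R integral {0..1/2} (G a b p0))) (at p0 within S)"
    using g(2)[OF p0S] p0S by (intro has_derivative_transform[of p0 S "K a b" g]) auto
  moreover have "at p0 within S = at p0"
    using p0S by (rule at_within_open) (simp add: S_def)
  ultimately show ?thesis
    by (simp add: has_vector_derivative_def)
qed

text \<open>\<open>K\<close> is a primitive that vanishes at 0 and has a limit at infinity, so the
  order of integration is never exchanged directly.\<close>

lemma has_integral_G_half:
  "((\<lambda>p. integral {0..1/2} (G a b p)) has_integral L * integral {0..1/2} (beta_integrand a b)) {0<..}"
  using has_integral_improper[OF continuous_on_K has_vector_derivative_K K_at_top] by (simp add: K_0)

end

section \<open>Joining the two halves of the unit interval\<close>

lemma has_integral_G_sum:
  assumes "Re a > 0" "Re b > 0" "p > 0"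
  shows "(G a b p has_integral integral {0..1/2} (G a b p) + integral {0..1/2} (G b a p)) {0<..<1}"
  using assms by (intro has_integral_unit_interval_halves[where g = "G b a p"] integrable_integral G_integrable G_reflect)

text \<open>The right half is the left half with \<open>a\<close> and \<open>b\<close> swapped. Each
  contributes \<open>L\<close> times a half Beta integral, and the two half integrals add up to the
  full one.\<close>

lemma G_mellin:
  assumes a: "Re a > 0" and b: "Re b > 0"
  shows "((\<lambda>p. integral {0<..<1} (G a b p)) has_integral L * Beta a b) {0<..}"
proof -
  have int: "beta_integrand a b integrable_on {0..1/2}" if "Re a > 0" "Re b > 0" for a b
    using integrable_on_subinterval[of "beta_integrand a b" "{0..1}" 0 "1/2"] integrable_beta_integrand[OF that]
    by (simp add: integrable_on_Icc_iff_Ioo)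
  have "(beta_integrand a b has_integral
      integral {0..1/2} (beta_integrand a b) + integral {0..1/2} (beta_integrand b a)) {0<..<1}"
    by (intro has_integral_unit_interval_halves[where g = "beta_integrand b a"] integrable_integral int a b beta_integrand_reflect)
  then have Beta: "integral {0..1/2} (beta_integrand a b) + integral {0..1/2} (beta_integrand b a) = Beta a b"
    using has_integral_Beta_complex[OF a b] has_integral_unique by blast
  have "((\<lambda>p. integral {0..1/2} (G a b p) + integral {0..1/2} (G b a p)) has_integral
      L * integral {0..1/2} (beta_integrand a b) + L * integral {0..1/2} (beta_integrand b a)) {0<..}"
    by (intro has_integral_add has_integral_G_half a b)
  then have "((\<lambda>p. integral {0..1/2} (G a b p) + integral {0..1/2} (G b a p)) has_integral L * Beta a b) {0<..}"
    by (simp add: Beta flip: distrib_left)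
  then show ?thesis
    by (rule has_integral_eq[rotated]) (simp add: integral_unique[OF has_integral_G_sum] a b)
qed

end

subsection \<open>The Mittag-Leffler kernel\<close>

text \<open>\<open>F\<close> is the integral from 0 to u. Its limit exists by the assumed
  convergence at infinity, and a continuous function with a limit there is bounded.\<close>

lemma mellin_kernel_ml:
  assumes \<alpha>: "Re \<alpha> > 0" and int: "ml_gamma_integrand \<alpha> \<beta> \<gamma> s integrable_on {0<..}"
  obtains F M where "mellin_kernel (\<lambda>u. mittag_leffler3 \<alpha> \<beta> \<gamma> (- of_real u)) F s (ml_gamma \<alpha> \<beta> \<gamma> s) M"
proof -
  define g where "g = ml_gamma_integrand \<alpha> \<beta> \<gamma> s"
  define E where "E = (\<lambda>u. mittag_leffler3 \<alpha> \<beta> \<gamma> (- complex_of_real u))"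
  define F where "F = (\<lambda>u. integral {0..u} g)"
  have g_eq: "g u = of_real u powr (s - 1) * E u" for u
    by (simp add: g_def E_def ml_gamma_integrand_def)
  then have g_fun: "g = (\<lambda>u. of_real u powr (s - 1) * E u)" by (rule ext)
  have "isCont E u" for u
    unfolding E_def by (rule isCont_o2[OF _ isCont_mittag_leffler3[OF \<alpha>]]) (intro continuous_intros)
  then have E: "continuous_on A E" for A
    by (simp add: continuous_at_imp_continuous_on)
  have "(g has_integral ml_gamma \<alpha> \<beta> \<gamma> s) {0<..}"
    using int unfolding g_def ml_gamma_def by (rule integrable_integral)
  then have g_int: "\<And>b. g integrable_on {0..b}" and F_lim: "(F \<longlongrightarrow> ml_gamma \<alpha> \<beta> \<gamma> s) at_top"
    by (simp_all add: has_integral_greaterThan_iff has_integral_atLeast_iff F_def)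
  have F_cont: "continuous_on {0..} F"
    unfolding continuous_on_eq_continuous_within
  proof
    fix u :: real assume u: "u \<in> {0..}"
    have "continuous (at u within {0..u + 1}) F"
      using indefinite_integral_continuous_1[OF g_int, of "u + 1"] u
      by (auto simp: F_def continuous_on_eq_continuous_within)
    moreover have "at u within {0..u + 1} = at u within {0..}"
      by (rule at_within_nhd[of u "{..<u + 1}"]) auto
    ultimately show "continuous (at u within {0..}) F" by simp
  qed
  obtain M where M: "\<And>u. u \<ge> 0 \<Longrightarrow> norm (F u) \<le> M"
    by (rule tendsto_bounded_on_atLeast[OF F_cont F_lim]) blast
  have "mellin_kernel E F s (ml_gamma \<alpha> \<beta> \<gamma> s) M"
  proof
    fix u :: real assume u: "u > 0"
    have "continuous_on {0<..} g"
      unfolding g_fun by (intro continuous_on_mult continuous_on_of_real_powr_complex continuous_intros E) auto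
    then have "isCont g u"
      using u by (simp add: continuous_on_eq_continuous_at)
    \<comment> \<open>The endpoint u + 1 makes u an interior point, so the derivative within the
      interval is a full derivative.\<close>
    then have "(F has_vector_derivative g u) (at u within {0..u + 1} - {})"
      unfolding F_def using u
      by (intro integral_has_vector_derivative_continuous_at g_int) (auto intro: continuous_at_imp_continuous_within)
    then show "(F has_vector_derivative of_real u powr (s - 1) * E u) (at u)"
      using u by (simp add: at_within_Icc_at g_eq)
  next
    show "F 0 = 0" by (simp add: F_def)
  qed (rule E F_cont F_lim M; assumption?)+
  then show thesis unfolding E_def by (rule that)
qed

text \<open>The integrability assumption says that the integral defining \<open>ml_gamma\<close>
  converges, possibly conditionally. As \<open>integral\<close> defaults to 0, the conclusion also
  asserts that both integrals on the left exist; the Mellin variable p runs over the positive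
  reals.\<close>

theorem theorem2p7:
  fixes \<alpha> \<beta> \<gamma> s x y :: complex
  assumes "Re s > 0" and "Re (x + s) > 0" and "Re (y + s) > 0" and "Re \<alpha> > 0"
    and "ml_gamma_integrand \<alpha> \<beta> \<gamma> s integrable_on {0<..}"
  shows "(\<forall>p::real. p > 0 \<longrightarrow> ml_beta_integrand \<alpha> \<beta> \<gamma> (of_real p) x y integrable_on {0<..<1}) \<and>
         mellin_integrand (\<lambda>p. ml_beta \<alpha> \<beta> \<gamma> (of_real p) x y) s integrable_on {0<..} \<and>
         mellin_transform (\<lambda>p. ml_beta \<alpha> \<beta> \<gamma> (of_real p) x y) s =
           ml_gamma \<alpha> \<beta> \<gamma> s * Beta (x + s) (y + s)"
proof -
  obtain F M where "mellin_kernel (\<lambda>u. mittag_leffler3 \<alpha> \<beta> \<gamma> (- of_real u)) F s (ml_gamma \<alpha> \<beta> \<gamma> s) M"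
    using mellin_kernel_ml[OF assms(4,5)] .
  then interpret mellin_kernel "\<lambda>u. mittag_leffler3 \<alpha> \<beta> \<gamma> (- of_real u)" F s "ml_gamma \<alpha> \<beta> \<gamma> s" M .
  define I where "I = (\<lambda>p. integral {0<..<1} (G (x + s) (y + s) p))"
  \<comment> \<open>For positive bases, p^(s - 1) is (p / (t (1 - t)))^(s - 1) times t^(s - 1) (1 -
    t)^(s - 1). The last two powers shift x and y by s, leaving the denominator t (1 - t) of
    \<open>G\<close>.\<close>
  have G_eq: "G (x + s) (y + s) p t = of_real p powr (s - 1) * ml_beta_integrand \<alpha> \<beta> \<gamma> (of_real p) x y t"
    if p: "p > 0" and t: "t \<in> {0<..<1}" for p t
  proof -
    have "complex_of_real p powr (s - 1) = (of_real (p / (t * (1 - t))) * (of_real t * of_real (1 - t))) powr (s - 1)"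
      using t by simp
    also have "\<dots> = of_real (p / (t * (1 - t))) powr (s - 1) * (of_real t powr (s - 1) * of_real (1 - t) powr (s - 1))"
      using p t by (subst powr_times_real; (subst powr_times_real)?) (auto simp del: of_real_diff)
    finally have "complex_of_real p powr (s - 1) * (of_real t powr (x - 1) * of_real (1 - t) powr (y - 1)) =
        of_real (p / (t * (1 - t))) powr (s - 1) *
        (of_real t powr (s - 1) * of_real t powr (x - 1) * (of_real (1 - t) powr (s - 1) * of_real (1 - t) powr (y - 1)))"
      by (simp only: mult_ac)
    also have "of_real t powr (s - 1) * of_real t powr (x - 1) * (of_real (1 - t) powr (s - 1) * of_real (1 - t) powr (y - 1)) =
        beta_integrand (x + s) (y + s) t / of_real (t * (1 - t))"
      using t by (simp add: beta_integrand_def of_real_powr_minus_1 powr_add mult_ac del: of_real_diff)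
    finally show ?thesis
      by (simp add: G_def ml_beta_integrand_def flip: mult.assoc)
  qed
  \<comment> \<open>\<open>of_real p powr (s - 1)\<close> is nonzero for p > 0, so dividing by it
    transfers integrability from \<open>G\<close> to the generalized beta integrand.\<close>
  have ml: "(ml_beta_integrand \<alpha> \<beta> \<gamma> (of_real p) x y has_integral I p / of_real p powr (s - 1)) {0<..<1}"
    if p: "p > 0" for p
  proof -
    have "(G (x + s) (y + s) p has_integral I p) {0<..<1}"
      using has_integral_G_sum[OF assms(2,3) p] unfolding I_def by (blast intro: integrable_integral)
    from has_integral_divide[OF this, of "of_real p powr (s - 1)"] show ?thesis
      by (rule has_integral_eq[rotated]) (use p in \<open>simp add: G_eq\<close>)
  qed
  have "(I has_integral ml_gamma \<alpha> \<beta> \<gamma> s * Beta (x + s) (y + s)) {0<..}"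
    unfolding I_def by (rule G_mellin[OF assms(2,3)])
  then have "(mellin_integrand (\<lambda>p. ml_beta \<alpha> \<beta> \<gamma> (of_real p) x y) s has_integral
      ml_gamma \<alpha> \<beta> \<gamma> s * Beta (x + s) (y + s)) {0<..}"
    by (rule has_integral_eq[rotated]) (simp add: mellin_integrand_def ml_beta_def integral_unique[OF ml])
  then show ?thesis
    unfolding mellin_transform_def
    by (intro conjI allI impI has_integral_integrable[OF ml] has_integral_integrable integral_unique)
qed

end
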